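(* Let $L_1,L_2,C_1,C_2,R>0$, let $V_{\mathrm{in}}$ be a real constant, and let $A(\cdot)$ and $B$ be as in the context. Let $\epsilon$ and $T$ satisfy $0<2\epsilon\le T<\pi\sqrt{L_1C_1}$ and let $\mu^*\in\mathbb{PWM}(T,\epsilon)$. For $x_o\in\mathbb{R}^4$ let $\phi(t,x_o)$ denote the solution of $\dot\phi(t,x_o)=A(\mu^*(t))\phi(t,x_o)+B\mu^*(t)$ with $\phi(0,x_o)=x_o$. Then there exist positive constants $K$ and $\lambda$ such that for all $t\ge0$ and all $x_o,y_o\in\mathbb{R}^4$, $$\|\phi(t,x_o)-\phi(t,y_o)\|\le Ke^{-\lambda t}\|x_o-y_o\| .$$
   Context: $M'$ denotes the transpose of $M$, and $\|\cdot\|$ the Euclidean norm. Matrices: $P:=\frac12\operatorname{diag}(L_1,L_2,C_1,C_2)$; for $\mu\in[-0.5,0.5]$, $$A(\mu):=\tfrac12P^{-1}\left(A_0^q+\mu E_0^q\right),\qquad A_0^q=\begin{bmatrix}0&0&-0.5&0\\0&0&0.5&1\\0.5&-0.5&0&0\\0&-1&0&-1/R\end{bmatrix},\qquad E_0^q=\begin{bmatrix}0&0&1&0\\0&0&1&0\\-1&-1&0&0\\0&0&0&0\end{bmatrix};$$ $$B:=\tfrac12P^{-1}\,[\,2V_{\mathrm{in}}\ \ 2V_{\mathrm{in}}\ \ 0\ \ 0\,]'.$$ Switching signals: for $0<2\epsilon\le T$, a signal $\mu:\mathbb{R}\to\{-0.5,0.5\}$ is of class $\mathbb{PWM}(T,\epsilon)$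 if it is right-continuous and for every integer $k$ there is a time $t_k$ with $kT+\epsilon\le t_k\le(k+1)T-\epsilon$ such that $\mu(t)=0.5$ for $kT\le t<t_k$ and $\mu(t)=-0.5$ for $t_k\le t<(k+1)T$. A solution is a locally absolutely continuous function of $t$ satisfying the differential equation for almost every $t$. *)

theory Defs
  imports "HOL-Analysis.Analysis"
begin

text \<open>\<^term>\<open>vector\<close> lists components from index 1, and a list of lists lists the rows of a matrix;
  in the index type \<^typ>\<open>4\<close> the last index is written both 4 and 0.\<close>

definition P_mat :: "real \<Rightarrow> real \<Rightarrow> real \<Rightarrow> real \<Rightarrow> real^4^4" where
  "P_mat L\<^sub>1 L\<^sub>2 C\<^sub>1 C\<^sub>2 = (1/2) *\<^sub>R vector
     [vector [L\<^sub>1, 0, 0, 0],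
      vector [0, L\<^sub>2, 0, 0],
      vector [0, 0, C\<^sub>1, 0],
      vector [0, 0, 0, C\<^sub>2]]"

definition A0q :: "real \<Rightarrow> real^4^4" where
  "A0q R = vector
     [vector [0, 0, -1/2, 0],
      vector [0, 0, 1/2, 1],
      vector [1/2, -1/2, 0, 0],
      vector [0, -1, 0, -1/R]]"

definition E0q :: "real^4^4" where
  "E0q = vector
     [vector [0, 0, 1, 0],
      vector [0, 0, 1, 0],
      vector [-1, -1, 0, 0],
      vector [0, 0, 0, 0]]"

definition A_mat :: "real \<Rightarrow> real \<Rightarrow> real \<Rightarrow> real \<Rightarrow> real \<Rightarrow> real \<Rightarrow> real^4^4" where
  "A_mat L\<^sub>1 L\<^sub>2 C\<^sub>1 C\<^sub>2 R \<mu> =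
     (1/2) *\<^sub>R (matrix_inv (P_mat L\<^sub>1 L\<^sub>2 C\<^sub>1 C\<^sub>2) ** (A0q R + \<mu> *\<^sub>R E0q))"

definition B_vec :: "real \<Rightarrow> real \<Rightarrow> real \<Rightarrow> real \<Rightarrow> real \<Rightarrow> real^4" where
  "B_vec L\<^sub>1 L\<^sub>2 C\<^sub>1 C\<^sub>2 V\<^sub>i\<^sub>n =
     (1/2) *\<^sub>R (matrix_inv (P_mat L\<^sub>1 L\<^sub>2 C\<^sub>1 C\<^sub>2) *v vector [2 * V\<^sub>i\<^sub>n, 2 * V\<^sub>i\<^sub>n, 0, 0])"

definition PWM :: "real \<Rightarrow> real \<Rightarrow> (real \<Rightarrow> real) set" where
  "PWM T \<epsilon> = {\<mu>.
     range \<mu> \<subseteq> {-1/2, 1/2} \<and>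
     (\<forall>t. continuous (at_right t) \<mu>) \<and>
     (\<forall>k::int. \<exists>s. of_int k * T + \<epsilon> \<le> s \<and> s \<le> (of_int k + 1) * T - \<epsilon> \<and>
        (\<forall>t\<in>{of_int k * T..<s}. \<mu> t = 1/2) \<and>
        (\<forall>t\<in>{s..<(of_int k + 1) * T}. \<mu> t = -1/2))}"

definition absolutely_continuous_on :: "real set \<Rightarrow> (real \<Rightarrow> 'a::metric_space) \<Rightarrow> bool" where
  "absolutely_continuous_on S f \<longleftrightarrow>
     (\<forall>e>0. \<exists>d>0. \<forall>(n::nat) a b.
        (\<forall>i<n. a i \<le> b i \<and> {a i..b i} \<subseteq> S) \<and>
        disjoint_family_on (\<lambda>i. {a i<..<b i}) {..<n} \<and>
        (\<Sum>i<n. b i - a i) < d \<longrightarrow>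
        (\<Sum>i<n. dist (f (a i)) (f (b i))) < e)"

definition locally_absolutely_continuous_on :: "real set \<Rightarrow> (real \<Rightarrow> 'a::metric_space) \<Rightarrow> bool" where
  "locally_absolutely_continuous_on S f \<longleftrightarrow>
     (\<forall>a b. {a..b} \<subseteq> S \<longrightarrow> absolutely_continuous_on {a..b} f)"

text \<open>Intended for an interval \<open>J\<close>.\<close>

definition caratheodory_solution_on ::
    "real set \<Rightarrow> (real \<Rightarrow> 'a::real_normed_vector \<Rightarrow> 'a) \<Rightarrow> (real \<Rightarrow> 'a) \<Rightarrow> bool" where
  "caratheodory_solution_on J f x \<longleftrightarrow>
     locally_absolutely_continuous_on J x \<and>
     (AE t in lebesgue. t \<in> J \<longrightarrow> (x has_vector_derivative f t (x t)) (at t within J))"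

end

theory Submission
  imports Defs
begin

text \<open>
  The difference \<open>z\<close> of two solutions solves the homogeneous system, along which the stored
  energy \<open>V = L\<^sub>1 z\<^sub>1\<^sup>2 + L\<^sub>2 z\<^sub>2\<^sup>2 + C\<^sub>1 z\<^sub>3\<^sup>2 + C\<^sub>2 z\<^sub>4\<^sup>2\<close> has derivative \<open>- 2 z\<^sub>4\<^sup>2 / R\<close>. If \<open>V\<close> hardly drops
  during an interval with \<open>\<mu> = 1/2\<close>, then \<open>z\<^sub>4\<close>, hence \<open>z\<^sub>2\<close> (as \<open>C\<^sub>2 z\<^sub>4' = - z\<^sub>2 - z\<^sub>4 / R\<close>),
  hence \<open>z\<^sub>3\<close> (as \<open>L\<^sub>2 z\<^sub>2' = z\<^sub>3 + z\<^sub>4\<close>) are small there. While \<open>\<mu> = - 1/2\<close>, the pair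
  \<open>(\<surd>L\<^sub>1 z\<^sub>1, \<surd>C\<^sub>1 z\<^sub>3)\<close> rotates by an angle in a compact subset of \<open>(0, \<pi>)\<close>, because
  \<open>T < \<pi> \<surd>(L\<^sub>1 C\<^sub>1)\<close>; as \<open>z\<^sub>3\<close> is small before and after the rotation, \<open>z\<^sub>1\<close> is small as well. So
  over one period and the first \<open>\<epsilon>\<close> of the next one \<open>V\<close> loses a fixed fraction of its value.
\<close>

subsection \<open>Absolutely continuous functions\<close>

text \<open>Enumerating \<open>I\<close> by a bijection from \<open>{..<card I}\<close> removes the
  restriction to natural-number indices, so that the pairs of a tagged division can serve as
  indices.\<close>

lemma absolutely_continuous_on_finite_family:
  fixes f :: "real \<Rightarrow> 'a::metric_space"
  assumes "absolutely_continuous_on S f" "e > 0"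
  obtains d where "d > 0" "\<forall>(I :: 'i set) a b. finite I \<and> (\<forall>i\<in>I. a i \<le> b i \<and> {a i..b i} \<subseteq> S) \<and>
      disjoint_family_on (\<lambda>i. {a i<..<b i}) I \<and> (\<Sum>i\<in>I. b i - a i) < d \<longrightarrow>
      (\<Sum>i\<in>I. dist (f (a i)) (f (b i))) < e"
proof -
  obtain d where "d > 0" and d: "\<forall>(n::nat) a b.
        (\<forall>i<n. a i \<le> b i \<and> {a i..b i} \<subseteq> S) \<and>
        disjoint_family_on (\<lambda>i. {a i<..<b i}) {..<n} \<and>
        (\<Sum>i<n. b i - a i) < d \<longrightarrow>
        (\<Sum>i<n. dist (f (a i)) (f (b i))) < e"
    using assms unfolding absolutely_continuous_on_def by blast
  show thesis
  proof (rule that[OF \<open>d > 0\<close>], intro allI impI, elim conjE)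
    fix I :: "'i set" and a b :: "'i \<Rightarrow> real"
    assume I: "finite I" "\<forall>i\<in>I. a i \<le> b i \<and> {a i..b i} \<subseteq> S"
      "disjoint_family_on (\<lambda>i. {a i<..<b i}) I" "(\<Sum>i\<in>I. b i - a i) < d"
    obtain h where h: "bij_betw h {..<card I} I"
      using ex_bij_betw_nat_finite[OF I(1)] by (auto simp: atLeast0LessThan)
    have mem: "h i \<in> I" if "i < card I" for i
      using h that by (auto dest: bij_betwE)
    have "(\<Sum>i<card I. dist (f (a (h i))) (f (b (h i)))) < e"
    proof (rule d[rule_format], intro conjI allI impI)
      show "disjoint_family_on (\<lambda>i. {a (h i)<..<b (h i)}) {..<card I}"
        unfolding disjoint_family_on_def
      proof (intro ballI impI)
        fix i j assume "i \<in> {..<card I}" "j \<in> {..<card I}" "i \<noteq> j"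
        then have "h i \<in> I" "h j \<in> I" "h i \<noteq> h j"
          using h mem by (auto simp: bij_betw_def inj_on_def)
        then show "{a (h i)<..<b (h i)} \<inter> {a (h j)<..<b (h j)} = {}"
          using I(3) unfolding disjoint_family_on_def by simp
      qed
      show "(\<Sum>i<card I. b (h i) - a (h i)) < d"
        using I(4) sum.reindex_bij_betw[OF h, of "\<lambda>i. b i - a i"] by simp
    qed (use I(2) mem in auto)
    then show "(\<Sum>i\<in>I. dist (f (a i)) (f (b i))) < e"
      using sum.reindex_bij_betw[OF h, of "\<lambda>i. dist (f (a i)) (f (b i))"] by simp
  qed
qed

lemma absolutely_continuous_on_imp_continuous_on:
  fixes f :: "real \<Rightarrow> 'a::metric_space"
  assumes "absolutely_continuous_on {a..b} f"
  shows "continuous_on {a..b} f"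
proof (clarsimp simp: continuous_on_iff)
  fix t e :: real assume t: "a \<le> t" "t \<le> b" and "e > 0"
  \<comment> \<open>A family with one member, the interval between \<open>s\<close> and
    \<open>t\<close>, is enough.\<close>
  obtain d where "d > 0" and d: "\<forall>(I :: unit set) u v. finite I \<and> (\<forall>i\<in>I. u i \<le> v i \<and> {u i..v i} \<subseteq> {a..b}) \<and>
      disjoint_family_on (\<lambda>i. {u i<..<v i}) I \<and> (\<Sum>i\<in>I. v i - u i) < d \<longrightarrow>
      (\<Sum>i\<in>I. dist (f (u i)) (f (v i))) < e"
    by (rule absolutely_continuous_on_finite_family[OF assms \<open>e > 0\<close>])
  have "dist (f s) (f t) < e" if "s \<in> {a..b}" "dist s t < d" for s
    using d[rule_format, of "{()}" "\<lambda>_. min s t" "\<lambda>_. max s t"] that t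
    by (cases "s \<le> t") (auto simp: disjoint_family_on_def dist_real_def min_def max_def dist_commute)
  then show "\<exists>d>0. \<forall>s\<in>{a..b}. dist s t < d \<longrightarrow> dist (f s) (f t) < e"
    using \<open>d > 0\<close> by blast
qed

text \<open>
  Off the null set \<open>N\<close> of exceptional points the gauge comes from differentiability; on \<open>N\<close> it is an
  open cover of small measure, so that absolute continuity controls the subintervals tagged there.
\<close>

theorem fundamental_theorem_of_calculus_absolutely_continuous:
  fixes f :: "real \<Rightarrow> 'a::banach"
  assumes "a \<le> b" and ac: "absolutely_continuous_on {a..b} f"
    and deriv: "AE t in lebesgue. t \<in> {a..b} \<longrightarrow> (f has_vector_derivative f' t) (at t within {a..b})"
  shows "(f' has_integral f b - f a) {a..b}"
proof -
  define N where "N = {t\<in>{a..b}. \<not> (f has_vector_derivative f' t) (at t within {a..b})}"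
  define g where "g t = (if t \<in> N then 0 else f' t)" for t
  have "N = {t \<in> space lebesgue. \<not> (t \<in> {a..b} \<longrightarrow> (f has_vector_derivative f' t) (at t within {a..b}))}"
    by (auto simp: N_def)
  then have N: "negligible N"
    using deriv by (simp only: negligible_iff_null_sets completion.AE_iff_null_sets)
  have "(g has_integral f b - f a) {a..b}"
  proof (cases "a = b")
    case False
    with \<open>a \<le> b\<close> have ab: "a < b" by simp
    show ?thesis
      unfolding has_integral_factor_content_real
    proof (intro allI impI)
      fix e :: real assume "e > 0"
      \<comment> \<open>Half of the admissible error \<open>e * (b - a)\<close> goes to the
        intervals tagged in \<open>N\<close>, half to the others.\<close>
      have pos: "0 < e / 2 * (b - a)"
        using \<open>e > 0\<close> ab by simp
      obtain d where "d > 0" and d: "\<forall>(I :: (real \<times> real set) set) u v. finite I \<and>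
          (\<forall>i\<in>I. u i \<le> v i \<and> {u i..v i} \<subseteq> {a..b}) \<and>
          disjoint_family_on (\<lambda>i. {u i<..<v i}) I \<and> (\<Sum>i\<in>I. v i - u i) < d \<longrightarrow>
          (\<Sum>i\<in>I. dist (f (u i)) (f (v i))) < e / 2 * (b - a)"
        by (rule absolutely_continuous_on_finite_family[OF ac pos])
      obtain U where "open U" "N \<subseteq> U" and U: "U - N \<in> lmeasurable" "emeasure lebesgue (U - N) < ennreal d"
        by (rule sets_lebesgue_outer_open[OF negligible_imp_sets[OF N] \<open>d > 0\<close>])
      have Um: "U \<in> lmeasurable" "measure lebesgue U < d"
      proof -
        have "U - N \<union> N = U" using \<open>N \<subseteq> U\<close> by auto
        then show "U \<in> lmeasurable"
          using fmeasurable.Un[OF U(1) negligible_imp_measurable[OF N]] by simp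
        then have "measure lebesgue U = measure lebesgue (U - N)"
          using N by (simp add: measure_Diff_null_set negligible_iff_null_sets)
        then show "measure lebesgue U < d"
          using U \<open>d > 0\<close> by (simp add: emeasure_eq_measure2 ennreal_less_iff)
      qed
      \<comment> \<open>Stated for every \<open>t\<close>, vacuously outside
        \<open>{a..b} - N\<close>, so that a radius function on all reals can be chosen.\<close>
      have "\<exists>r>0. t \<in> {a..b} - N \<longrightarrow> (\<forall>y\<in>{a..b}. norm (y - t) < r \<longrightarrow>
               norm (f y - f t - (y - t) *\<^sub>R f' t) \<le> e / 2 * norm (y - t))" for t
      proof (cases "t \<in> {a..b} - N")
        case True
        then have "(f has_derivative (\<lambda>h. h *\<^sub>R f' t)) (at t within {a..b})"
          by (auto simp: N_def has_vector_derivative_def)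
        then show ?thesis
          using \<open>e > 0\<close> unfolding has_derivative_within_alt by (meson half_gt_zero)
      qed (auto intro: exI[of _ 1])
      then obtain r where r0: "\<And>t. r t > 0"
        and r: "\<And>t y. t \<in> {a..b} - N \<Longrightarrow> y \<in> {a..b} \<Longrightarrow> norm (y - t) < r t \<Longrightarrow>
                norm (f y - f t - (y - t) *\<^sub>R f' t) \<le> e / 2 * norm (y - t)"
        by metis
      define \<gamma> where "\<gamma> t = (if t \<in> N then U else ball t (r t))" for t
      have gauge: "gauge \<gamma>"
        using \<open>open U\<close> \<open>N \<subseteq> U\<close> r0 by (auto simp: gauge_def \<gamma>_def)
      have main: "norm ((\<Sum>(x, K)\<in>p. measure lborel K *\<^sub>R g x) - (f b - f a)) \<le> e * measure lborel {a..b}"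
        if p: "p tagged_division_of {a..b}" and fine: "\<gamma> fine p" for p
      proof -
        note pD = tagged_division_ofD[OF p]
        have K: "a \<le> Inf K" "Inf K \<le> x" "x \<le> Sup K" "Sup K \<le> b" "Inf K \<in> K" "Sup K \<in> K"
          and K_measure: "measure lborel K = Sup K - Inf K" "measure lebesgue K = Sup K - Inf K"
          and K_interior: "interior K = {Inf K<..<Sup K}"
          and K_fine: "K \<subseteq> \<gamma> x" if xK: "(x, K) \<in> p" for x K
        proof -
          obtain u v where "K = {u..v}" using pD(4)[OF xK] by auto
          with pD(2,3)[OF xK] fineD[OF fine xK]
          show "a \<le> Inf K" "Inf K \<le> x" "x \<le> Sup K" "Sup K \<le> b" "Inf K \<in> K" "Sup K \<in> K"
            "measure lborel K = Sup K - Inf K" "measure lebesgue K = Sup K - Inf K"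
            "interior K = {Inf K<..<Sup K}" "K \<subseteq> \<gamma> x"
            by auto
        qed
        \<comment> \<open>The error on one tagged interval; as the increments of \<open>f\<close>
          telescope over the division, these errors add up to the total one.\<close>
        let ?D = "\<lambda>(x, K). measure lborel K *\<^sub>R g x - (f (Sup K) - f (Inf K))"
        define q where "q = {(x, K)\<in>p. x \<in> N}"
        have q: "finite q" "q \<subseteq> p" using pD(1) by (auto simp: q_def intro: finite_subset)
        have "(\<Sum>(x, K)\<in>p. measure lborel K *\<^sub>R g x) - (f b - f a) = (\<Sum>i\<in>p. ?D i)"
          by (simp only: additive_tagged_division_1[OF \<open>a \<le> b\<close> p, of f, symmetric]
              sum_subtractf case_prod_unfold)
        also have "\<dots> = (\<Sum>i\<in>q. ?D i) + (\<Sum>i\<in>p - q. ?D i)"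
          using sum.subset_diff[OF q(2) pD(1), of ?D] by (simp only: add.commute)
        finally have split: "norm ((\<Sum>(x, K)\<in>p. measure lborel K *\<^sub>R g x) - (f b - f a))
            \<le> norm (\<Sum>i\<in>q. ?D i) + norm (\<Sum>i\<in>p - q. ?D i)"
          by (simp add: norm_triangle_ineq)
        have "norm (\<Sum>i\<in>q. ?D i) \<le> (\<Sum>i\<in>q. dist (f (Inf (snd i))) (f (Sup (snd i))))"
          by (rule sum_norm_le) (auto simp: q_def g_def dist_norm norm_minus_commute)
        also have "\<dots> < e / 2 * (b - a)"
        proof (rule d[rule_format], intro conjI ballI)
          fix i assume "i \<in> q"
          then have "(fst i, snd i) \<in> p" using q(2) by auto
          from K[OF this] show "Inf (snd i) \<le> Sup (snd i)" "{Inf (snd i)..Sup (snd i)} \<subseteq> {a..b}"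
            by auto
        next
          show "disjoint_family_on (\<lambda>i. {Inf (snd i)<..<Sup (snd i)}) q"
            unfolding disjoint_family_on_def
          proof (intro ballI impI)
            fix i j assume ij: "i \<in> q" "j \<in> q" "i \<noteq> j"
            obtain x K y L where [simp]: "i = (x, K)" "j = (y, L)" by fastforce
            have mem: "(x, K) \<in> p" "(y, L) \<in> p" "(x, K) \<noteq> (y, L)"
              using ij q(2) by auto
            have "interior K \<inter> interior L = {}"
              by (rule pD(5)[OF mem])
            moreover have "interior K = {Inf K<..<Sup K}" "interior L = {Inf L<..<Sup L}"
              by (fact K_interior[OF mem(1)] K_interior[OF mem(2)])+
            ultimately show "{Inf (snd i)<..<Sup (snd i)} \<inter> {Inf (snd j)<..<Sup (snd j)} = {}"
              by simp
          qed
          \<comment> \<open>The intervals in \<open>q\<close> do not overlap and lie in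
            \<open>U\<close>, so their total length is the measure of their union and stays below
            \<open>d\<close>.\<close>
          have "q tagged_partial_division_of {a..b}"
            using p q(2) by (meson tagged_division_of_def tagged_partial_division_subset)
          then have qd: "q tagged_division_of \<Union>(snd ` q)"
            by (rule tagged_partial_division_of_Union_self)
          have "(\<Sum>i\<in>q. Sup (snd i) - Inf (snd i)) = (\<Sum>(x, K)\<in>q. measure lborel K)"
            using q(2) by (intro sum.cong) (auto simp: K_measure)
          also have "\<dots> = (\<Sum>K\<in>snd ` q. measure lborel K)"
            by (rule sum.over_tagged_division_lemma[OF qd]) (simp add: content_eq_0_interior)
          also have "\<dots> = (\<Sum>K\<in>snd ` q. measure lebesgue K)"
            using q(2) by (intro sum.cong) (auto simp: K_measure)
          also have "\<dots> = measure lebesgue (\<Union>(snd ` q))"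
            by (rule content_division[OF division_of_tagged_division[OF qd]])
          also have "\<dots> \<le> measure lebesgue U"
          proof (rule measure_mono_fmeasurable)
            show "\<Union> (snd ` q) \<subseteq> U"
              using K_fine q by (fastforce simp: q_def \<gamma>_def)
            show "\<Union> (snd ` q) \<in> sets lebesgue"
              using division_of_tagged_division[OF qd] lmeasurable_division by blast
          qed (rule Um)
          finally show "(\<Sum>i\<in>q. Sup (snd i) - Inf (snd i)) < d" using Um by simp
        qed (rule q)
        finally have 1: "norm (\<Sum>i\<in>q. ?D i) < e / 2 * (b - a)" .
        have "norm (\<Sum>i\<in>p - q. ?D i) \<le> (\<Sum>i\<in>p - q. e / 2 * measure lborel (snd i))"
        proof (rule sum_norm_le)
          fix i assume i: "i \<in> p - q"
          obtain x K where [simp]: "i = (x, K)" by fastforce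
          have xK: "(x, K) \<in> p" and x: "x \<in> {a..b} - N"
            using i pD(2,3)[of x K] by (auto simp: q_def)
          note Kx = K[OF xK] K_measure[OF xK]
          have "norm (Inf K - x) < r x" "norm (Sup K - x) < r x"
            using K_fine[OF xK] Kx(5,6) x by (auto simp: \<gamma>_def dist_norm norm_minus_commute subset_eq)
          then have "norm (f (Sup K) - f x - (Sup K - x) *\<^sub>R f' x) \<le> e / 2 * (Sup K - x)"
            "norm (f (Inf K) - f x - (Inf K - x) *\<^sub>R f' x) \<le> e / 2 * (x - Inf K)"
            using r[OF x, of "Sup K"] r[OF x, of "Inf K"] Kx x by auto
          \<comment> \<open>Subtracting the expansions at the two ends cancels \<open>f x\<close>
            and leaves the increment over \<open>K\<close>; since the tag lies in \<open>K\<close>,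
            the two distances add up to its length.\<close>
          then have "norm ((f (Inf K) - f x - (Inf K - x) *\<^sub>R f' x) - (f (Sup K) - f x - (Sup K - x) *\<^sub>R f' x))
              \<le> e / 2 * (x - Inf K) + e / 2 * (Sup K - x)"
            by (meson add_mono norm_triangle_le_diff)
          moreover have "(f (Inf K) - f x - (Inf K - x) *\<^sub>R f' x) - (f (Sup K) - f x - (Sup K - x) *\<^sub>R f' x) = ?D i"
            using x by (simp add: g_def K_measure[OF xK] algebra_simps)
          moreover have "e / 2 * (x - Inf K) + e / 2 * (Sup K - x) = e / 2 * measure lborel (snd i)"
            by (simp add: K_measure[OF xK] distrib_left[symmetric])
          ultimately show "norm (?D i) \<le> e / 2 * measure lborel (snd i)"
            by (simp only:)
        qed
        also have "\<dots> \<le> (\<Sum>i\<in>p. e / 2 * measure lborel (snd i))"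
          by (rule sum_mono2; use pD(1) \<open>e > 0\<close> in simp)
        also have "\<dots> = e / 2 * (\<Sum>(x, K)\<in>p. measure lborel K)"
          by (subst sum_distrib_left) (rule sum.cong, auto)
        also have "\<dots> = e / 2 * (b - a)"
          using additive_content_tagged_division[of p a b] p measure_lborel_Icc[OF \<open>a \<le> b\<close>]
          by (simp only: box_real)
        finally have 2: "norm (\<Sum>i\<in>p - q. ?D i) \<le> e / 2 * (b - a)" .
        have "e * measure lborel {a..b} = e / 2 * (b - a) + e / 2 * (b - a)"
          unfolding measure_lborel_Icc[OF \<open>a \<le> b\<close>] by (simp add: algebra_simps)
        then show ?thesis
          using order_trans[OF split add_mono[OF less_imp_le[OF 1] 2]] by (simp only:)
      qed
      show "\<exists>\<gamma>. gauge \<gamma> \<and> (\<forall>p. p tagged_division_of {a..b} \<and> \<gamma> fine p \<longrightarrow>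
          norm ((\<Sum>(x, K)\<in>p. measure lborel K *\<^sub>R g x) - (f b - f a)) \<le> e * measure lborel {a..b})"
      proof (intro exI conjI allI impI)
        show "gauge \<gamma>" by (rule gauge)
      qed (blast intro: main)
    qed
  qed auto
  then show ?thesis
    by (rule has_integral_spike[OF N, rotated]) (simp add: g_def)
qed

subsection \<open>Elementary estimates\<close>

text \<open>
  On a subinterval of length \<open>h\<close> the mean value theorem gives a point where \<open>\<bar>g\<bar> \<le> 2\<delta> / h\<close>, and \<open>g\<close>
  varies by at most \<open>L h\<close> on it.
\<close>

lemma derivative_small_if_small:
  fixes l L \<eta> :: real
  assumes "l > 0" "\<eta> > 0"
  obtains \<delta> where "\<delta> > 0"
    "\<forall>a b f g k. l \<le> b - a \<and>
      (\<forall>t\<in>{a..b}. (f has_real_derivative g t) (at t within {a..b}) \<and>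
        (g has_real_derivative k t) (at t within {a..b}) \<and> \<bar>k t\<bar> \<le> L \<and> \<bar>f t\<bar> \<le> \<delta>) \<longrightarrow>
      (\<forall>t\<in>{a..b}. \<bar>g t\<bar> \<le> \<eta>)"
proof -
  \<comment> \<open>The first bound makes room for a subinterval of length \<open>h\<close> on one
    side of any point, the second keeps the variation of \<open>g\<close> over it below
    \<open>\<eta> / 2\<close>. Using \<open>\<bar>L\<bar> + 1\<close> avoids a zero or negative
    denominator.\<close>
  define h where "h = min (l / 2) (\<eta> / (2 * (\<bar>L\<bar> + 1)))"
  have h: "0 < h" "h \<le> l / 2" "(\<bar>L\<bar> + 1) * h \<le> \<eta> / 2"
    using assms by (auto simp: h_def min_le_iff_disj field_simps min_mult_distrib_left)
  have "h * \<eta> / 4 > 0" using h assms by simp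
  then show thesis
  proof (rule that, intro allI impI ballI)
    fix a b t :: real and f g k :: "real \<Rightarrow> real"
    assume asm: "l \<le> b - a \<and>
      (\<forall>t\<in>{a..b}. (f has_real_derivative g t) (at t within {a..b}) \<and>
        (g has_real_derivative k t) (at t within {a..b}) \<and> \<bar>k t\<bar> \<le> L \<and> \<bar>f t\<bar> \<le> h * \<eta> / 4)"
      and t: "t \<in> {a..b}"
    have ab: "l \<le> b - a" using asm by simp
    have f: "(f has_real_derivative g t) (at t within {a..b})"
      and g: "(g has_real_derivative k t) (at t within {a..b})"
      and k: "\<bar>k t\<bar> \<le> L" and small: "\<bar>f t\<bar> \<le> h * \<eta> / 4" if "t \<in> {a..b}" for t
      using asm that by auto
    \<comment> \<open>If \<open>h\<close> does not fit to the right of \<open>t\<close>, it fits to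
      the left, because \<open>2 * h \<le> l\<close>.\<close>
    define u where "u = (if t + h \<le> b then t else t - h)"
    have u: "u < u + h" "{u..u + h} \<subseteq> {a..b}" "t \<in> {u..u + h}"
      using t ab h by (auto simp: u_def)
    have "\<exists>\<xi>\<in>{u<..<u + h}. f (u + h) - f u = (\<lambda>d. g \<xi> * d) (u + h - u)"
    proof (rule mvt_simple)
      fix x assume "u \<le> x" "x \<le> u + h"
      then have "(f has_real_derivative g x) (at x within {a..b})"
        using f u(2) by (auto simp: subset_eq)
      then show "(f has_derivative (\<lambda>d. g x * d)) (at x within {u..u + h})"
        using u(2) unfolding has_field_derivative_def by (rule has_derivative_subset)
    qed (rule u)
    then obtain \<xi> where "\<xi> \<in> {u<..<u + h}" "f (u + h) - f u = g \<xi> * (u + h - u)"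
      by blast
    then have \<xi>: "\<xi> \<in> {u..u + h}" "f (u + h) - f u = g \<xi> * h"
      by auto
    have "\<bar>f u\<bar> \<le> h * \<eta> / 4" "\<bar>f (u + h)\<bar> \<le> h * \<eta> / 4"
      by (rule small; use u in \<open>simp add: subset_eq\<close>)+
    then have "\<bar>f (u + h) - f u\<bar> \<le> h * \<eta> / 4 + h * \<eta> / 4"
      by linarith
    then have "\<bar>g \<xi> * h\<bar> \<le> \<eta> / 2 * h"
      unfolding \<xi>(2) by (simp add: algebra_simps)
    then have "\<bar>g \<xi>\<bar> \<le> \<eta> / 2"
      using h(1) by (simp add: abs_mult)
    moreover have "norm (g t - g \<xi>) \<le> L * norm (t - \<xi>)"
      by (rule field_differentiable_bound[of "{a..b}" g k]) (use g k t \<xi> u in auto)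
    moreover have "L * norm (t - \<xi>) \<le> (\<bar>L\<bar> + 1) * h"
      using \<xi> u by (intro mult_mono) auto
    ultimately show "\<bar>g t\<bar> \<le> \<eta>" using h(3) by simp
  qed
qed

text \<open>The sine increases up to \<open>pi / 2\<close>, so there \<open>a\<close> gives the
  bound; beyond it, the reflection \<open>pi - x\<close> reduces to the increasing half and
  \<open>b\<close> gives the bound.\<close>

lemma sin_ge_min_endpoints:
  assumes "0 \<le> a" "a \<le> x" "x \<le> b" "b \<le> pi"
  shows "min (sin a) (sin b) \<le> sin x"
proof (cases "x \<le> pi / 2")
  case True
  then have "sin a \<le> sin x" using assms by (intro sin_monotone_2pi_le) auto
  then show ?thesis by simp
next
  case False
  have "sin (pi - b) \<le> sin (pi - x)" using assms False by (intro sin_monotone_2pi_le) auto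
  then show ?thesis by simp
qed

lemma vector_4:
  "(vector [w, x, y, z] :: ('a::zero)^4) $ 1 = w"
  "(vector [w, x, y, z] :: ('a::zero)^4) $ 2 = x"
  "(vector [w, x, y, z] :: ('a::zero)^4) $ 3 = y"
  "(vector [w, x, y, z] :: ('a::zero)^4) $ 4 = z"
  unfolding vector_def by simp_all

subsection \<open>The two linear modes\<close>

locale cuk_converter =
  fixes L\<^sub>1 L\<^sub>2 C\<^sub>1 C\<^sub>2 R :: real
  assumes pos: "L\<^sub>1 > 0" "L\<^sub>2 > 0" "C\<^sub>1 > 0" "C\<^sub>2 > 0" "R > 0"
begin

text \<open>The quadratic form of the diagonal matrix \<open>2 P\<close>.\<close>

definition energy :: "real^4 \<Rightarrow> real" where
  "energy x = L\<^sub>1 * (x $ 1)\<^sup>2 + L\<^sub>2 * (x $ 2)\<^sup>2 + C\<^sub>1 * (x $ 3)\<^sup>2 + C\<^sub>2 * (x $ 4)\<^sup>2"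

text \<open>The mode \<mu> = 1/2. The first component is frozen and does not influence the others,
  so it can only be detected through the other mode.\<close>

definition field_on :: "real^4 \<Rightarrow> real^4" where
  "field_on x = vector [0, (x $ 3 + x $ 4) / L\<^sub>2, - x $ 2 / C\<^sub>1, (- x $ 2 - x $ 4 / R) / C\<^sub>2]"

text \<open>The mode \<mu> = -1/2. Components 1 and 3 form an undamped oscillator decoupled from
  components 2 and 4.\<close>

definition field_off :: "real^4 \<Rightarrow> real^4" where
  "field_off x = vector [- x $ 3 / L\<^sub>1, x $ 4 / L\<^sub>2, x $ 1 / C\<^sub>1, (- x $ 2 - x $ 4 / R) / C\<^sub>2]"

text \<open>Derivatives are relative to the closed interval, so at a switching instant each mode has
  its own one-sided derivative.\<close>

definition solves :: "(real^4 \<Rightarrow> real^4) \<Rightarrow> real \<Rightarrow> real \<Rightarrow> (real \<Rightarrow> real^4) \<Rightarrow> bool" where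
  "solves F a b z \<longleftrightarrow> (\<forall>t\<in>{a..b}. (z has_vector_derivative F (z t)) (at t within {a..b}))"

section \<open>The matrix system as two explicit vector fields\<close>

lemma P_mat_invertible: "invertible (P_mat L\<^sub>1 L\<^sub>2 C\<^sub>1 C\<^sub>2)"
proof -
  have "P_mat L\<^sub>1 L\<^sub>2 C\<^sub>1 C\<^sub>2 ** (4 *\<^sub>R P_mat (1 / L\<^sub>1) (1 / L\<^sub>2) (1 / C\<^sub>1) (1 / C\<^sub>2)) = mat 1"
    using pos by (simp add: P_mat_def vec_eq_iff forall_4 matrix_matrix_mult_def sum_4 vector_4 mat_def)
  then show ?thesis
    unfolding invertible_right_inverse by blast
qed

text \<open>Multiplying by \<open>2 P\<close> clears the inverse, which therefore never has to be
  computed.\<close>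

lemma A_mat_mult: "2 *\<^sub>R (P_mat L\<^sub>1 L\<^sub>2 C\<^sub>1 C\<^sub>2 *v (A_mat L\<^sub>1 L\<^sub>2 C\<^sub>1 C\<^sub>2 R \<mu> *v x)) = (A0q R + \<mu> *\<^sub>R E0q) *v x"
proof -
  have "P_mat L\<^sub>1 L\<^sub>2 C\<^sub>1 C\<^sub>2 ** matrix_inv (P_mat L\<^sub>1 L\<^sub>2 C\<^sub>1 C\<^sub>2) = mat 1"
    using someI_ex[OF P_mat_invertible[unfolded invertible_def]] unfolding matrix_inv_def by simp
  then show ?thesis
    by (simp add: A_mat_def matrix_vector_mul_assoc matrix_mul_assoc scaleR_matrix_vector_assoc[symmetric]
        matrix_vector_mult_scaleR)
qed

lemma A_mat_on: "A_mat L\<^sub>1 L\<^sub>2 C\<^sub>1 C\<^sub>2 R (1/2) *v x = field_on x"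
proof -
  \<comment> \<open>Treated as an unknown, \<open>y\<close> is determined componentwise by a
    diagonal linear system.\<close>
  define y where "y = A_mat L\<^sub>1 L\<^sub>2 C\<^sub>1 C\<^sub>2 R (1/2) *v x"
  have "2 *\<^sub>R (P_mat L\<^sub>1 L\<^sub>2 C\<^sub>1 C\<^sub>2 *v y) = (A0q R + (1/2) *\<^sub>R E0q) *v x"
    unfolding y_def by (rule A_mat_mult)
  then show ?thesis
    unfolding y_def[symmetric] using pos
    by (simp add: vec_eq_iff forall_4 matrix_vector_mult_def sum_4 vector_4
        P_mat_def A0q_def E0q_def field_on_def field_simps)
qed

lemma A_mat_off: "A_mat L\<^sub>1 L\<^sub>2 C\<^sub>1 C\<^sub>2 R (-1/2) *v x = field_off x"
proof -
  define y where "y = A_mat L\<^sub>1 L\<^sub>2 C\<^sub>1 C\<^sub>2 R (-1/2) *v x"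
  have "2 *\<^sub>R (P_mat L\<^sub>1 L\<^sub>2 C\<^sub>1 C\<^sub>2 *v y) = (A0q R + (-1/2) *\<^sub>R E0q) *v x"
    unfolding y_def by (rule A_mat_mult)
  then show ?thesis
    unfolding y_def[symmetric] using pos
    by (simp add: vec_eq_iff forall_4 matrix_vector_mult_def sum_4 vector_4
        P_mat_def A0q_def E0q_def field_off_def field_simps)
qed

lemma solves_component:
  assumes "solves F a b z" "t \<in> {a..b}"
  shows "((\<lambda>t. z t $ i) has_real_derivative F (z t) $ i) (at t within {a..b})"
  unfolding has_real_derivative_iff_has_vector_derivative
  by (rule bounded_linear.has_vector_derivative[OF bounded_linear_vec_nth])
    (use assms in \<open>simp add: solves_def\<close>)

lemma solves_subset:
  assumes "solves F a b z" "a \<le> a'" "b' \<le> b"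
  shows "solves F a' b' z"
  using assms unfolding solves_def
  by (auto intro: has_vector_derivative_within_subset[of z _ _ "{a..b}"])

lemma field_scaleR: "field_on (c *\<^sub>R x) = c *\<^sub>R field_on x" "field_off (c *\<^sub>R x) = c *\<^sub>R field_off x"
  by (simp_all add: field_on_def field_off_def vec_eq_iff forall_4 vector_4 algebra_simps add_divide_distrib diff_divide_distrib)

text \<open>Allows trajectories to be normalized to initial energy 1.\<close>

lemma solves_scaleR:
  assumes "solves F a b z" "F = field_on \<or> F = field_off"
  shows "solves F a b (\<lambda>t. c *\<^sub>R z t)"
  using assms by (auto simp: solves_def field_scaleR intro!: derivative_eq_intros)

section \<open>The energy along trajectories\<close>

lemma energy_scaleR: "energy (c *\<^sub>R x) = c\<^sup>2 * energy x"
  by (simp add: energy_def algebra_simps power_mult_distrib)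

text \<open>Apart from the entry \<open>-1/R\<close>, the matrix
  \<open>A0q R + \<mu> *\<^sub>R E0q\<close> is skew-symmetric, so in both modes only the resistor
  dissipates.\<close>

lemma energy_has_derivative:
  assumes z: "solves F a b z" and F: "F = field_on \<or> F = field_off" and t: "t \<in> {a..b}"
  shows "((\<lambda>t. energy (z t)) has_real_derivative - (2 / R) * (z t $ 4)\<^sup>2) (at t within {a..b})"
  unfolding energy_def
  apply (rule derivative_eq_intros refl solves_component[OF z t])+
  using F pos by (auto simp: field_on_def field_off_def vector_4 field_simps power2_eq_square)

lemma energy_antimono:
  assumes z: "solves F a b z" and F: "F = field_on \<or> F = field_off" and "a \<le> u" "u \<le> v" "v \<le> b"
  shows "energy (z v) \<le> energy (z u)"
proof (cases "u = v")
  case False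
  have "\<exists>\<xi>\<in>{u<..<v}. energy (z v) - energy (z u) = (\<lambda>d. - (2 / R) * (z \<xi> $ 4)\<^sup>2 * d) (v - u)"
  proof (rule mvt_simple)
    fix t assume "u \<le> t" "t \<le> v"
    then have "((\<lambda>t. energy (z t)) has_real_derivative - (2 / R) * (z t $ 4)\<^sup>2) (at t within {u..v})"
      using energy_has_derivative[OF solves_subset[OF z] F] assms by auto
    then show "((\<lambda>t. energy (z t)) has_derivative (\<lambda>d. - (2 / R) * (z t $ 4)\<^sup>2 * d)) (at t within {u..v})"
      by (simp only: has_field_derivative_def)
  qed (use False assms in simp)
  then obtain \<xi> where "energy (z v) - energy (z u) = - (2 / R) * (z \<xi> $ 4)\<^sup>2 * (v - u)" by blast
  also have "\<dots> \<le> 0"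
    using pos assms by (simp add: mult_nonpos_nonneg)
  finally show ?thesis by simp
qed simp

section \<open>Comparison of the energy with the norm\<close>

definition min_coeff :: real where "min_coeff = min (min L\<^sub>1 L\<^sub>2) (min C\<^sub>1 C\<^sub>2)"
definition max_coeff :: real where "max_coeff = max (max L\<^sub>1 L\<^sub>2) (max C\<^sub>1 C\<^sub>2)"

lemma coeff_pos: "min_coeff > 0" "max_coeff > 0"
  using pos by (auto simp: min_coeff_def max_coeff_def)

lemma norm_sq: "(norm (x::real^4))\<^sup>2 = (x $ 1)\<^sup>2 + (x $ 2)\<^sup>2 + (x $ 3)\<^sup>2 + (x $ 4)\<^sup>2"
  unfolding power2_norm_eq_inner inner_vec_def sum_4 by (simp add: power2_eq_square)

lemma energy_ge: "min_coeff * (norm x)\<^sup>2 \<le> energy x"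
  unfolding norm_sq energy_def distrib_left
  by (intro add_mono mult_right_mono) (auto simp: min_coeff_def)

lemma energy_le: "energy x \<le> max_coeff * (norm x)\<^sup>2"
  unfolding norm_sq energy_def distrib_left
  by (intro add_mono mult_right_mono) (auto simp: max_coeff_def)

lemma energy_nonneg: "energy x \<ge> 0"
  using pos by (simp add: energy_def)

lemma component_bound:
  assumes "energy x \<le> 1"
  shows "\<bar>x $ i\<bar> \<le> 1 / sqrt min_coeff"
proof -
  have "(norm x)\<^sup>2 \<le> 1 / min_coeff"
    using energy_ge[of x] assms coeff_pos by (simp add: field_simps)
  then have "norm x \<le> 1 / sqrt min_coeff"
    using real_le_rsqrt by (fastforce simp: real_sqrt_divide)
  then show ?thesis using component_le_norm_cart[of x i] by linarith
qed

text \<open>Three uses of \<open>derivative_small_if_small\<close> pass smallness from the energy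
  drop to component 4, then to 2, then to 3. The threshold depends on \<open>l\<close> and
  \<open>\<eta>\<close> only, not on the interval or the trajectory.\<close>

lemma on_observability:
  assumes "l > 0" "\<eta> > 0"
  obtains \<delta> where "\<delta> > 0"
    "\<And>a b z t. \<lbrakk>l \<le> b - a; solves field_on a b z; energy (z a) \<le> 1; energy (z a) - energy (z b) \<le> \<delta>;
      t \<in> {a..b}\<rbrakk> \<Longrightarrow> \<bar>z t $ 2\<bar> \<le> \<eta> \<and> \<bar>z t $ 3\<bar> \<le> \<eta> \<and> \<bar>z t $ 4\<bar> \<le> \<eta>"
proof -
  define \<beta> where "\<beta> = 1 / sqrt min_coeff"
  have \<beta>: "\<beta> > 0" using coeff_pos by (simp add: \<beta>_def)
  \<comment> \<open>A bound for the derivative of component 4 when all components are at most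
    \<open>\<beta>\<close>.\<close>
  define M where "M = (\<beta> + \<beta> / R) / C\<^sub>2"
  \<comment> \<open>Thresholds are chosen backwards, from the last use to the first. In each, the
    bound on \<open>k\<close> is a bound for a second derivative: here of component 2, then of
    component 4, then of the energy.\<close>
  obtain \<delta>3 where \<delta>3: "\<delta>3 > 0"
    "\<forall>a b f g k. l \<le> b - a \<and>
      (\<forall>t\<in>{a..b}. (f has_real_derivative g t) (at t within {a..b}) \<and>
        (g has_real_derivative k t) (at t within {a..b}) \<and> \<bar>k t\<bar> \<le> (\<beta> / C\<^sub>1 + M) / L\<^sub>2 \<and> \<bar>f t\<bar> \<le> \<delta>3) \<longrightarrow>
      (\<forall>t\<in>{a..b}. \<bar>g t\<bar> \<le> \<eta> / 2 / L\<^sub>2)"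
    by (rule derivative_small_if_small[OF assms(1), where \<eta> = "\<eta> / 2 / L\<^sub>2"]) (use assms pos in simp_all)
  define \<eta>2 where "\<eta>2 = min \<delta>3 \<eta>"
  have \<eta>2: "\<eta>2 > 0" "\<eta>2 \<le> \<delta>3" "\<eta>2 \<le> \<eta>" using assms \<delta>3 by (auto simp: \<eta>2_def)
  obtain \<delta>2 where \<delta>2: "\<delta>2 > 0"
    "\<forall>a b f g k. l \<le> b - a \<and>
      (\<forall>t\<in>{a..b}. (f has_real_derivative g t) (at t within {a..b}) \<and>
        (g has_real_derivative k t) (at t within {a..b}) \<and> \<bar>k t\<bar> \<le> ((\<beta> + \<beta>) / L\<^sub>2 + M / R) / C\<^sub>2 \<and> \<bar>f t\<bar> \<le> \<delta>2) \<longrightarrow>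
      (\<forall>t\<in>{a..b}. \<bar>g t\<bar> \<le> \<eta>2 / 2 / C\<^sub>2)"
    by (rule derivative_small_if_small[OF assms(1), where \<eta> = "\<eta>2 / 2 / C\<^sub>2"]) (use \<eta>2 pos in simp_all)
  \<comment> \<open>The three entries serve in turn as input to the next use, as a bound keeping
    \<open>z\<^sub>4 / R\<close> within \<open>\<eta>2 / 2\<close>, and as room for passing from
    \<open>z\<^sub>3 + z\<^sub>4\<close> to \<open>z\<^sub>3\<close>.\<close>
  define \<eta>1 where "\<eta>1 = min \<delta>2 (min (R * \<eta>2 / 2) (\<eta> / 2))"
  have \<eta>1: "\<eta>1 > 0" "\<eta>1 \<le> \<delta>2" "\<eta>1 \<le> R * \<eta>2 / 2" "\<eta>1 \<le> \<eta> / 2"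
    using assms \<delta>2 \<eta>2 pos by (auto simp: \<eta>1_def)
  obtain \<delta> where \<delta>: "\<delta> > 0"
    "\<forall>a b f g k. l \<le> b - a \<and>
      (\<forall>t\<in>{a..b}. (f has_real_derivative g t) (at t within {a..b}) \<and>
        (g has_real_derivative k t) (at t within {a..b}) \<and> \<bar>k t\<bar> \<le> 4 / R * (\<beta> * M) \<and> \<bar>f t\<bar> \<le> \<delta>) \<longrightarrow>
      (\<forall>t\<in>{a..b}. \<bar>g t\<bar> \<le> 2 / R * \<eta>1\<^sup>2)"
    by (rule derivative_small_if_small[OF assms(1), where \<eta> = "2 / R * \<eta>1\<^sup>2"]) (use \<eta>1 pos in simp_all)
  show thesis
  proof (rule that[OF \<delta>(1)])
    fix a b t z
    assume ab: "l \<le> b - a" and z: "solves field_on a b z" and z1: "energy (z a) \<le> 1"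
      and drop: "energy (z a) - energy (z b) \<le> \<delta>" and t: "t \<in> {a..b}"
    have bound: "\<bar>z t $ i\<bar> \<le> \<beta>" if "t \<in> {a..b}" for t i
      unfolding \<beta>_def using energy_antimono[OF z, of a t] that z1 by (intro component_bound) auto
    note D = solves_component[OF z]
    have field: "field_on x $ 1 = 0" "field_on x $ 2 = (x $ 3 + x $ 4) / L\<^sub>2"
      "field_on x $ 3 = - x $ 2 / C\<^sub>1" "field_on x $ 4 = (- x $ 2 - x $ 4 / R) / C\<^sub>2" for x
      by (simp_all add: field_on_def vector_4)
    have field4: "\<bar>field_on (z t) $ 4\<bar> \<le> M" if "t \<in> {a..b}" for t
    proof -
      have "\<bar>- z t $ 2 - z t $ 4 / R\<bar> \<le> \<bar>z t $ 2\<bar> + \<bar>z t $ 4\<bar> / R"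
        using pos abs_triangle_ineq4[of "- z t $ 2" "z t $ 4 / R"] by simp
      also have "\<dots> \<le> \<beta> + \<beta> / R"
        using bound[OF that] pos by (intro add_mono divide_right_mono) auto
      finally show ?thesis using pos by (simp add: field M_def divide_right_mono)
    qed
    have x4: "\<bar>z t $ 4\<bar> \<le> \<eta>1" if t: "t \<in> {a..b}" for t
    proof -
      have "\<bar>- (2 / R) * (z t $ 4)\<^sup>2\<bar> \<le> 2 / R * \<eta>1\<^sup>2"
      proof (rule \<delta>(2)[rule_format, where f = "\<lambda>t. energy (z t) - energy (z a)" and k = "\<lambda>t. - (4 / R) * (z t $ 4 * field_on (z t) $ 4)",
            OF conjI[OF ab ballI] t], intro conjI)
        fix t assume t: "t \<in> {a..b}"
        show "((\<lambda>t. energy (z t) - energy (z a)) has_real_derivative - (2 / R) * (z t $ 4)\<^sup>2) (at t within {a..b})"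
          by (rule derivative_eq_intros refl energy_has_derivative[OF z _ t])+ auto
        show "((\<lambda>t. - (2 / R) * (z t $ 4)\<^sup>2) has_real_derivative - (4 / R) * (z t $ 4 * field_on (z t) $ 4)) (at t within {a..b})"
          by (rule derivative_eq_intros refl D[OF t])+ simp
        have "\<bar>z t $ 4\<bar> * \<bar>field_on (z t) $ 4\<bar> \<le> \<beta> * M"
          using bound[OF t] field4[OF t] \<beta> by (intro mult_mono) auto
        then show "\<bar>- (4 / R) * (z t $ 4 * field_on (z t) $ 4)\<bar> \<le> 4 / R * (\<beta> * M)"
          using pos by (simp add: abs_mult divide_right_mono)
        have "energy (z b) \<le> energy (z t)" "energy (z t) \<le> energy (z a)"
          using energy_antimono[OF z, of t b] energy_antimono[OF z, of a t] t by auto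
        then show "\<bar>energy (z t) - energy (z a)\<bar> \<le> \<delta>" using drop by linarith
      qed
      then have "(z t $ 4)\<^sup>2 \<le> \<eta>1\<^sup>2"
        using pos by (simp add: abs_mult divide_le_cancel)
      then show ?thesis using \<eta>1(1) abs_le_square_iff[of "z t $ 4" \<eta>1] by simp
    qed
    have x2: "\<bar>z t $ 2\<bar> \<le> \<eta>2" if t: "t \<in> {a..b}" for t
    proof -
      have "\<bar>field_on (z t) $ 4\<bar> \<le> \<eta>2 / 2 / C\<^sub>2"
      proof (rule \<delta>2(2)[rule_format, where f = "\<lambda>t. z t $ 4" and k = "\<lambda>t. (- field_on (z t) $ 2 - field_on (z t) $ 4 / R) / C\<^sub>2",
            OF conjI[OF ab ballI] t], intro conjI)
        fix t assume t: "t \<in> {a..b}"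
        show "((\<lambda>t. z t $ 4) has_real_derivative field_on (z t) $ 4) (at t within {a..b})"
          by (rule D[OF t])
        show "((\<lambda>t. field_on (z t) $ 4) has_real_derivative
            (- field_on (z t) $ 2 - field_on (z t) $ 4 / R) / C\<^sub>2) (at t within {a..b})"
          unfolding field(4) using pos by (auto intro!: derivative_eq_intros D[OF t] simp: field(4))
        have "\<bar>field_on (z t) $ 2\<bar> \<le> (\<beta> + \<beta>) / L\<^sub>2"
          using bound[OF t, of 3] bound[OF t, of 4] pos by (auto simp: field intro!: divide_right_mono)
        moreover have "\<bar>field_on (z t) $ 4 / R\<bar> \<le> M / R"
          using field4[OF t] pos by (simp add: divide_right_mono)
        ultimately have "\<bar>- field_on (z t) $ 2 - field_on (z t) $ 4 / R\<bar> \<le> (\<beta> + \<beta>) / L\<^sub>2 + M / R"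
          by linarith
        then show "\<bar>(- field_on (z t) $ 2 - field_on (z t) $ 4 / R) / C\<^sub>2\<bar> \<le> ((\<beta> + \<beta>) / L\<^sub>2 + M / R) / C\<^sub>2"
          using pos by (simp only: abs_divide abs_of_pos divide_right_mono less_imp_le)
        show "\<bar>z t $ 4\<bar> \<le> \<delta>2" using x4[OF t] \<eta>1 by simp
      qed
      then have "\<bar>- z t $ 2 - z t $ 4 / R\<bar> \<le> \<eta>2 / 2"
        using pos by (simp only: field abs_divide abs_of_pos divide_le_cancel)
      moreover have "\<bar>z t $ 4 / R\<bar> \<le> \<eta>2 / 2"
        using x4[OF t] \<eta>1 pos by (simp add: field_simps)
      ultimately show ?thesis by linarith
    qed
    have x3: "\<bar>z t $ 3 + z t $ 4\<bar> \<le> \<eta> / 2" if t: "t \<in> {a..b}" for t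
    proof -
      have "\<bar>field_on (z t) $ 2\<bar> \<le> \<eta> / 2 / L\<^sub>2"
      proof (rule \<delta>3(2)[rule_format, where f = "\<lambda>t. z t $ 2" and k = "\<lambda>t. (field_on (z t) $ 3 + field_on (z t) $ 4) / L\<^sub>2",
            OF conjI[OF ab ballI] t], intro conjI)
        fix t assume t: "t \<in> {a..b}"
        show "((\<lambda>t. z t $ 2) has_real_derivative field_on (z t) $ 2) (at t within {a..b})"
          by (rule D[OF t])
        show "((\<lambda>t. field_on (z t) $ 2) has_real_derivative
            (field_on (z t) $ 3 + field_on (z t) $ 4) / L\<^sub>2) (at t within {a..b})"
          unfolding field(2) using pos by (auto intro!: derivative_eq_intros D[OF t])
        have "\<bar>field_on (z t) $ 3\<bar> \<le> \<beta> / C\<^sub>1"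
          using bound[OF t, of 2] pos by (auto simp: field intro!: divide_right_mono)
        then have "\<bar>field_on (z t) $ 3 + field_on (z t) $ 4\<bar> \<le> \<beta> / C\<^sub>1 + M"
          using field4[OF t] by linarith
        then show "\<bar>(field_on (z t) $ 3 + field_on (z t) $ 4) / L\<^sub>2\<bar> \<le> (\<beta> / C\<^sub>1 + M) / L\<^sub>2"
          using pos by (simp only: abs_divide abs_of_pos divide_right_mono less_imp_le)
        show "\<bar>z t $ 2\<bar> \<le> \<delta>3" using x2[OF t] \<eta>2 by simp
      qed
      then show ?thesis
        using pos by (simp only: field abs_divide abs_of_pos divide_le_cancel)
    qed
    show "\<bar>z t $ 2\<bar> \<le> \<eta> \<and> \<bar>z t $ 3\<bar> \<le> \<eta> \<and> \<bar>z t $ 4\<bar> \<le> \<eta>"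
      using x4[OF t] x2[OF t] x3[OF t] \<eta>1 \<eta>2 by linarith
  qed
qed

text \<open>The angular frequency of the oscillator formed by components 1 and 3 when \<mu> =
  -1/2.\<close>

definition \<omega> :: real where "\<omega> = 1 / sqrt (L\<^sub>1 * C\<^sub>1)"

text \<open>The function \<open>q\<close> below rotates the state at time \<open>t\<close> through
  the angle remaining until \<open>b\<close>; it is constant, and its values at \<open>s\<close> and
  \<open>b\<close> are the two sides.\<close>

lemma off_rotation:
  assumes z: "solves field_off s b z" and "s \<le> b"
  shows "sqrt C\<^sub>1 * z b $ 3 = cos (\<omega> * (b - s)) * (sqrt C\<^sub>1 * z s $ 3) + sin (\<omega> * (b - s)) * (sqrt L\<^sub>1 * z s $ 1)"
proof -
  define q where "q t = cos (\<omega> * (b - t)) * (sqrt C\<^sub>1 * z t $ 3) + sin (\<omega> * (b - t)) * (sqrt L\<^sub>1 * z t $ 1)" for t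
  \<comment> \<open>These identities make the terms in the derivative of \<open>q\<close> cancel in
    pairs.\<close>
  have *: "sqrt C\<^sub>1 / C\<^sub>1 = \<omega> * sqrt L\<^sub>1" "sqrt L\<^sub>1 / L\<^sub>1 = \<omega> * sqrt C\<^sub>1"
    using pos by (auto simp: \<omega>_def real_sqrt_mult field_simps)
  have "\<exists>c. \<forall>t\<in>{s..b}. q t = c"
  proof (rule has_field_derivative_zero_constant)
    fix t assume t: "t \<in> {s..b}"
    have 3: "((\<lambda>t. z t $ 3) has_real_derivative z t $ 1 / C\<^sub>1) (at t within {s..b})"
      using solves_component[OF z t, of 3] by (simp add: field_off_def vector_4)
    have 1: "((\<lambda>t. z t $ 1) has_real_derivative - z t $ 3 / L\<^sub>1) (at t within {s..b})"
      using solves_component[OF z t, of 1] by (simp add: field_off_def vector_4)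
    have "(q has_real_derivative \<omega> * sin (\<omega> * (b - t)) * (sqrt C\<^sub>1 * z t $ 3)
        + cos (\<omega> * (b - t)) * (sqrt C\<^sub>1 / C\<^sub>1 * z t $ 1)
        - \<omega> * cos (\<omega> * (b - t)) * (sqrt L\<^sub>1 * z t $ 1)
        - sin (\<omega> * (b - t)) * (sqrt L\<^sub>1 / L\<^sub>1 * z t $ 3)) (at t within {s..b})"
      unfolding q_def by (auto intro!: derivative_eq_intros 1 3 simp: algebra_simps)
    then show "(q has_real_derivative 0) (at t within {s..b})"
      unfolding * by (simp add: algebra_simps)
  qed simp
  then have "q b = q s" using \<open>s \<le> b\<close> by force
  then show ?thesis by (simp add: q_def)
qed

subsection \<open>Decay of the energy\<close>

text \<open>The window extends by \<open>\<epsilon>\<close> into the next period because component 3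
  must be known to be small at both ends of the rotation. The factor is uniform in the switching
  instant \<open>s\<close>.\<close>

lemma window_contraction:
  assumes "0 < \<epsilon>" "2 * \<epsilon> \<le> T" "\<omega> * T < pi"
  obtains \<delta> where "0 < \<delta>" "\<delta> < 1"
    "\<And>a s z. \<lbrakk>a + \<epsilon> \<le> s; s \<le> a + T - \<epsilon>; solves field_on a s z; solves field_off s (a + T) z;
       solves field_on (a + T) (a + T + \<epsilon>) z\<rbrakk> \<Longrightarrow> energy (z (a + T + \<epsilon>)) \<le> (1 - \<delta>) * energy (z a)"
proof -
  have \<omega>: "\<omega> > 0" using pos by (simp add: \<omega>_def)
  \<comment> \<open>A positive lower bound for the sine of every possible rotation angle.\<close>
  define \<sigma> where "\<sigma> = min (sin (\<omega> * \<epsilon>)) (sin (\<omega> * (T - \<epsilon>)))"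
  have "\<omega> * \<epsilon> < \<omega> * T" "\<omega> * (T - \<epsilon>) < \<omega> * T"
    using \<omega> assms by auto
  with assms have le_pi: "\<omega> * \<epsilon> < pi" "\<omega> * (T - \<epsilon>) < pi"
    by linarith+
  then have \<sigma>: "\<sigma> > 0"
    using \<omega> assms by (auto simp: \<sigma>_def intro!: sin_gt_zero)
  have sin_ge: "\<sigma> \<le> sin (\<omega> * \<tau>)" if "\<epsilon> \<le> \<tau>" "\<tau> \<le> T - \<epsilon>" for \<tau>
    unfolding \<sigma>_def using that \<omega> assms le_pi by (intro sin_ge_min_endpoints) auto
  \<comment> \<open>If components 2 to 4 at \<open>s\<close> and component 3 at \<open>a + T\<close>
    are at most \<open>\<eta>\<close>, the rotation bounds component 1 at \<open>s\<close> by
    \<open>c * \<eta>\<close>, and the energy there by \<open>D * \<eta>\<^sup>2\<close>. So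
    \<open>\<eta>\<close> is chosen to make the latter \<open>1 / 2\<close>.\<close>
  define c where "c = 2 * sqrt C\<^sub>1 / (\<sigma> * sqrt L\<^sub>1)"
  have c: "c > 0" using \<sigma> pos by (simp add: c_def)
  define D where "D = L\<^sub>1 * c\<^sup>2 + L\<^sub>2 + C\<^sub>1 + C\<^sub>2"
  have D: "D > 0" using pos by (simp add: D_def add_nonneg_pos)
  define \<eta> where "\<eta> = sqrt (1 / (2 * D))"
  have \<eta>: "\<eta> > 0" "D * \<eta>\<^sup>2 = 1 / 2" using D by (auto simp: \<eta>_def)
  obtain d where d: "d > 0"
    "\<And>a b z t. \<lbrakk>\<epsilon> \<le> b - a; solves field_on a b z; energy (z a) \<le> 1; energy (z a) - energy (z b) \<le> d;
      t \<in> {a..b}\<rbrakk> \<Longrightarrow> \<bar>z t $ 2\<bar> \<le> \<eta> \<and> \<bar>z t $ 3\<bar> \<le> \<eta> \<and> \<bar>z t $ 4\<bar> \<le> \<eta>"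
    using on_observability[OF assms(1) \<eta>(1)] by blast
  \<comment> \<open>If less than \<open>\<delta>\<close> is lost, the bound \<open>d\<close> makes
    both observability arguments apply, while \<open>1 / 4\<close> leaves an energy above
    \<open>1 / 2\<close> at \<open>s\<close>.\<close>
  define \<delta> where "\<delta> = min d (1 / 4)"
  have \<delta>: "0 < \<delta>" "\<delta> < 1" "\<delta> < 1 / 2" "\<delta> \<le> d" using d(1) by (auto simp: \<delta>_def)
  have normalized: "energy (z (a + T + \<epsilon>)) \<le> 1 - \<delta>"
    if s: "a + \<epsilon> \<le> s" "s \<le> a + T - \<epsilon>" and z: "solves field_on a s z" "solves field_off s (a + T) z"
      "solves field_on (a + T) (a + T + \<epsilon>) z" and 1: "energy (z a) = 1" for a s z
  proof (rule ccontr)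
    assume "\<not> ?thesis"
    moreover have mono: "energy (z s) \<le> energy (z a)" "energy (z (a + T)) \<le> energy (z s)"
      "energy (z (a + T + \<epsilon>)) \<le> energy (z (a + T))"
      using energy_antimono[OF z(1), of a s] energy_antimono[OF z(2), of s "a + T"]
        energy_antimono[OF z(3), of "a + T" "a + T + \<epsilon>"] s assms by auto
    ultimately have drop: "energy (z a) - energy (z s) \<le> d" "energy (z (a + T)) - energy (z (a + T + \<epsilon>)) \<le> d"
      "1 / 2 < energy (z s)" "energy (z (a + T)) \<le> 1"
      using 1 \<delta> by linarith+
    have small: "\<bar>z s $ 2\<bar> \<le> \<eta>" "\<bar>z s $ 3\<bar> \<le> \<eta>" "\<bar>z s $ 4\<bar> \<le> \<eta>" "\<bar>z (a + T) $ 3\<bar> \<le> \<eta>"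
      using d(2)[OF _ z(1), of s] d(2)[OF _ z(3), of "a + T"] s 1 drop assms by auto
    define \<theta> where "\<theta> = \<omega> * (a + T - s)"
    have sin: "\<sigma> \<le> sin \<theta>" unfolding \<theta>_def using s by (intro sin_ge) auto
    have "s \<le> a + T" using s assms by simp
    from off_rotation[OF z(2) this]
    have "sin \<theta> * (sqrt L\<^sub>1 * z s $ 1) = sqrt C\<^sub>1 * z (a + T) $ 3 - cos \<theta> * (sqrt C\<^sub>1 * z s $ 3)"
      by (simp add: \<theta>_def)
    also have "\<bar>\<dots>\<bar> \<le> \<bar>sqrt C\<^sub>1 * z (a + T) $ 3\<bar> + \<bar>cos \<theta> * (sqrt C\<^sub>1 * z s $ 3)\<bar>"
      by (rule abs_triangle_ineq4)
    also have "\<dots> \<le> sqrt C\<^sub>1 * \<eta> + 1 * (sqrt C\<^sub>1 * \<eta>)"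
      unfolding abs_mult using small pos by (intro add_mono mult_mono) auto
    finally have "\<bar>sin \<theta>\<bar> * (sqrt L\<^sub>1 * \<bar>z s $ 1\<bar>) \<le> 2 * sqrt C\<^sub>1 * \<eta>"
      using pos by (simp add: abs_mult ac_simps)
    moreover have "\<sigma> * (sqrt L\<^sub>1 * \<bar>z s $ 1\<bar>) \<le> \<bar>sin \<theta>\<bar> * (sqrt L\<^sub>1 * \<bar>z s $ 1\<bar>)"
      using sin pos by (intro mult_right_mono) auto
    ultimately have "\<sigma> * (sqrt L\<^sub>1 * \<bar>z s $ 1\<bar>) \<le> 2 * sqrt C\<^sub>1 * \<eta>" by (rule order_trans[rotated])
    then have x1: "\<bar>z s $ 1\<bar> \<le> c * \<eta>"
      using \<sigma> pos by (simp add: c_def field_simps)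
    have sq: "x\<^sup>2 \<le> y\<^sup>2" if "\<bar>x\<bar> \<le> y" for x y :: real
      using power_mono[OF that, of 2] by simp
    have "energy (z s) \<le> L\<^sub>1 * (c * \<eta>)\<^sup>2 + L\<^sub>2 * \<eta>\<^sup>2 + C\<^sub>1 * \<eta>\<^sup>2 + C\<^sub>2 * \<eta>\<^sup>2"
      unfolding energy_def using small x1 pos by (intro add_mono mult_left_mono sq) auto
    also have "\<dots> = D * \<eta>\<^sup>2" by (simp add: D_def algebra_simps power_mult_distrib)
    finally show False using \<eta> drop by simp
  qed
  show thesis
  proof (rule that[OF \<delta>(1,2)])
    fix a s z
    assume s: "a + \<epsilon> \<le> s" "s \<le> a + T - \<epsilon>" and z: "solves field_on a s z" "solves field_off s (a + T) z"
      "solves field_on (a + T) (a + T + \<epsilon>) z"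
    show "energy (z (a + T + \<epsilon>)) \<le> (1 - \<delta>) * energy (z a)"
    proof (cases "energy (z a) = 0")
      case True
      have "energy (z (a + T + \<epsilon>)) \<le> energy (z a)"
        using energy_antimono[OF z(1), of a s] energy_antimono[OF z(2), of s "a + T"]
          energy_antimono[OF z(3), of "a + T" "a + T + \<epsilon>"] s assms by auto
      then show ?thesis using True by simp
    next
      case False
      \<comment> \<open>Scaling by \<open>k\<close> gives initial energy 1, since the energy is
        homogeneous of degree two.\<close>
      define k where "k = 1 / sqrt (energy (z a))"
      have k: "k\<^sup>2 = 1 / energy (z a)" and E: "energy (z a) > 0"
        using False energy_nonneg[of "z a"] by (auto simp: k_def power_divide)
      have "energy (k *\<^sub>R z (a + T + \<epsilon>)) \<le> 1 - \<delta>"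
        by (rule normalized[OF s]) (use z E in \<open>auto simp: energy_scaleR k intro!: solves_scaleR\<close>)
      then show ?thesis using E by (simp add: energy_scaleR k field_simps)
    qed
  qed
qed

text \<open>Windows started in consecutive periods overlap, so the contraction is iterated over
  every second period only.\<close>

lemma exponential_decay:
  assumes "0 < \<epsilon>" "2 * \<epsilon> \<le> T" "\<omega> * T < pi"
  obtains K lam where "K > 0" "lam > 0"
    "\<And>z t. \<lbrakk>\<And>k::nat. \<exists>s. real k * T + \<epsilon> \<le> s \<and> s \<le> (real k + 1) * T - \<epsilon> \<and>
        solves field_on (real k * T) s z \<and> solves field_off s ((real k + 1) * T) z; t \<ge> 0\<rbrakk>
      \<Longrightarrow> norm (z t) \<le> K * exp (- lam * t) * norm (z 0)"
proof -
  have T: "T > 0" using assms by simp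
  obtain \<delta> where \<delta>: "0 < \<delta>" "\<delta> < 1" and contr:
    "\<And>a s z. \<lbrakk>a + \<epsilon> \<le> s; s \<le> a + T - \<epsilon>; solves field_on a s z; solves field_off s (a + T) z;
       solves field_on (a + T) (a + T + \<epsilon>) z\<rbrakk> \<Longrightarrow> energy (z (a + T + \<epsilon>)) \<le> (1 - \<delta>) * energy (z a)"
    using window_contraction[OF assms] by blast
  define \<kappa> where "\<kappa> = - ln (1 - \<delta>)"
  have \<kappa>: "\<kappa> > 0" "exp (- \<kappa>) = 1 - \<delta>" using \<delta> by (auto simp: \<kappa>_def)
  \<comment> \<open>The factor \<open>exp \<kappa>\<close> pays for the incomplete last pair of
    periods, the quotient for passing between energy and norm.\<close>
  define K where "K = sqrt (exp \<kappa> * max_coeff / min_coeff)"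
  have K: "K > 0" "K\<^sup>2 = exp \<kappa> * max_coeff / min_coeff" using coeff_pos by (auto simp: K_def)
  \<comment> \<open>The energy decays by \<open>exp (- \<kappa>)\<close> per time
    \<open>2 * T\<close>; the norm has half that rate.\<close>
  define lam where "lam = \<kappa> / (4 * T)"
  have lam: "lam > 0" using \<kappa> T by (simp add: lam_def)
  show thesis
  proof (rule that[OF K(1) lam])
    fix z :: "real \<Rightarrow> real^4" and t :: real
    assume z: "\<And>k::nat. \<exists>s. real k * T + \<epsilon> \<le> s \<and> s \<le> (real k + 1) * T - \<epsilon> \<and>
        solves field_on (real k * T) s z \<and> solves field_off s ((real k + 1) * T) z" and t: "t \<ge> 0"
    obtain s :: "nat \<Rightarrow> real" where s: "\<And>k::nat. real k * T + \<epsilon> \<le> s k" "\<And>k::nat. s k \<le> (real k + 1) * T - \<epsilon>"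
      and on: "\<And>k::nat. solves field_on (real k * T) (s k) z"
      and off: "\<And>k::nat. solves field_off (s k) ((real k + 1) * T) z"
      using z by metis
    have mono: "energy (z u) \<le> energy (z (real k * T))" if "real k * T \<le> u" "u \<le> (real k + 1) * T" for k :: nat and u
    proof (cases "u \<le> s k")
      case True
      then show ?thesis using energy_antimono[OF on[of k], of "real k * T" u] that by auto
    next
      case False
      then have "energy (z u) \<le> energy (z (s k))"
        using energy_antimono[OF off[of k], of "s k" u] that by auto
      also have "\<dots> \<le> energy (z (real k * T))"
        using energy_antimono[OF on[of k], of "real k * T" "s k"] s[of k] assms by auto
      finally show ?thesis .
    qed
    have two_periods: "energy (z ((real k + 2) * T)) \<le> (1 - \<delta>) * energy (z (real k * T))" for k :: nat
    proof -
      let ?a = "real k * T"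
      have Suc: "real (Suc k) * T = ?a + T" "(real (Suc k) + 1) * T = ?a + 2 * T" "(real k + 1) * T = ?a + T"
        "(real k + 2) * T = ?a + 2 * T"
        by (auto simp: algebra_simps)
      have on': "solves field_on (?a + T) (?a + T + \<epsilon>) z"
        using s(1)[of "Suc k"] by (intro solves_subset[OF on[of "Suc k"]]) (simp_all only: Suc order_refl)
      have "energy (z (?a + T + \<epsilon>)) \<le> (1 - \<delta>) * energy (z ?a)"
        using s(1)[of k] s(2)[of k] on[of k] off[of k] on' unfolding Suc by (intro contr)
      moreover have "energy (z (?a + 2 * T)) \<le> energy (z (?a + T + \<epsilon>))"
      proof -
        have "energy (z (?a + 2 * T)) \<le> energy (z (s (Suc k)))"
          using energy_antimono[OF off[of "Suc k"], of "s (Suc k)" "?a + 2 * T"] s[of "Suc k"] assms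
          unfolding Suc by auto
        also have "\<dots> \<le> energy (z (?a + T + \<epsilon>))"
          using energy_antimono[OF on[of "Suc k"], of "?a + T + \<epsilon>" "s (Suc k)"] s[of "Suc k"] assms
          unfolding Suc by auto
        finally show ?thesis .
      qed
      ultimately show ?thesis unfolding Suc by simp
    qed
    have geometric: "energy (z (real (2 * j) * T)) \<le> (1 - \<delta>) ^ j * energy (z 0)" for j :: nat
    proof (induction j)
      case (Suc j)
      have "energy (z (real (2 * Suc j) * T)) \<le> (1 - \<delta>) * energy (z (real (2 * j) * T))"
        using two_periods[of "2 * j"] by (simp add: add.commute)
      also have "\<dots> \<le> (1 - \<delta>) * ((1 - \<delta>) ^ j * energy (z 0))"
        using Suc \<delta> by (intro mult_left_mono) auto
      finally show ?case by simp
    qed simp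
    define n where "n = nat \<lfloor>t / T\<rfloor>"
    have "real n \<le> t / T" "t / T < real n + 1"
      using t T by (auto simp: n_def)
    then have n: "real n * T \<le> t" "t \<le> (real n + 1) * T"
      using T by (auto simp: field_simps)
    define j where "j = n div 2"
    have "energy (z t) \<le> energy (z (real n * T))" using mono[OF n] .
    also have "\<dots> \<le> energy (z (real (2 * j) * T))"
    proof (cases "n = 2 * j")
      case False
      then have "n = 2 * j + 1" by (auto simp: j_def)
      then show ?thesis using mono[of "2 * j" "real n * T"] T by (auto simp: algebra_simps)
    qed simp
    also have "\<dots> \<le> (1 - \<delta>) ^ j * energy (z 0)" by (rule geometric)
    also have "(1 - \<delta>) ^ j = exp (- \<kappa> * j)"
      unfolding \<kappa>(2)[symmetric] by (simp add: exp_of_nat_mult[symmetric] mult.commute)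
    \<comment> \<open>Time \<open>t\<close> lies before the end of pair number \<open>j\<close>,
      hence \<open>t \<le> 2 * T * (j + 1)\<close>.\<close>
    also have "\<dots> \<le> exp (\<kappa> - 2 * lam * t)"
    proof -
      have "real n \<le> 2 * real j + 1" unfolding j_def by linarith
      then have "(real n + 1) * T \<le> (2 * real j + 2) * T"
        using T by (intro mult_right_mono) auto
      then have "t / (2 * T) \<le> real j + 1" using n T by (simp add: field_simps)
      then have "\<kappa> * (t / (2 * T)) \<le> \<kappa> * (real j + 1)" using \<kappa> by (intro mult_left_mono) auto
      moreover have "2 * lam * t = \<kappa> * (t / (2 * T))" by (simp add: lam_def)
      ultimately show ?thesis by (simp add: algebra_simps)
    qed
    finally have "energy (z t) \<le> exp (\<kappa> - 2 * lam * t) * energy (z 0)"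
      using energy_nonneg[of "z 0"] by (simp add: mult_right_mono)
    also have "\<dots> \<le> exp (\<kappa> - 2 * lam * t) * (max_coeff * (norm (z 0))\<^sup>2)"
      by (intro mult_left_mono energy_le) simp
    finally have "min_coeff * (norm (z t))\<^sup>2 \<le> exp (\<kappa> - 2 * lam * t) * (max_coeff * (norm (z 0))\<^sup>2)"
      using energy_ge[of "z t"] by simp
    then have "(norm (z t))\<^sup>2 \<le> exp (\<kappa> - 2 * lam * t) * (max_coeff * (norm (z 0))\<^sup>2) / min_coeff"
      using coeff_pos by (simp add: field_simps)
    also have "exp (\<kappa> - 2 * lam * t) = exp \<kappa> * (exp (- lam * t))\<^sup>2"
      by (simp add: exp_double[symmetric] exp_add[symmetric] algebra_simps)
    also have "exp \<kappa> * (exp (- lam * t))\<^sup>2 * (max_coeff * (norm (z 0))\<^sup>2) / min_coeff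
        = (K * exp (- lam * t) * norm (z 0))\<^sup>2"
      by (simp add: power_mult_distrib K(2))
    finally show "norm (z t) \<le> K * exp (- lam * t) * norm (z 0)"
      by (rule power2_le_imp_le) (use K in simp)
  qed
qed

end

subsection \<open>Differences of Caratheodory solutions\<close>

text \<open>The difference is the integral of its almost-everywhere derivative; a continuous
  integrand makes it differentiable everywhere, including the endpoints.\<close>

lemma caratheodory_difference_has_vector_derivative:
  fixes x y :: "real \<Rightarrow> 'a::banach"
  assumes x: "caratheodory_solution_on J f x" and y: "caratheodory_solution_on J f y"
    and ab: "{a..b} \<subseteq> J" and cont: "continuous_on {a..b} g"
    and g: "\<And>t. t \<in> {a..<b} \<Longrightarrow> f t (x t) - f t (y t) = g t" and t: "t \<in> {a..b}"
  shows "((\<lambda>t. x t - y t) has_vector_derivative g t) (at t within {a..b})"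
proof -
  have ftc: "((\<lambda>t. f t (v t)) has_integral v u - v a) {a..u}"
    if v: "caratheodory_solution_on J f v" and u: "u \<in> {a..b}" for u v
  proof (rule fundamental_theorem_of_calculus_absolutely_continuous)
    have sub: "{a..u} \<subseteq> J" using ab u by force
    then show "absolutely_continuous_on {a..u} v"
      using v by (simp add: caratheodory_solution_on_def locally_absolutely_continuous_on_def)
    have "AE t in lebesgue. t \<in> J \<longrightarrow> (v has_vector_derivative f t (v t)) (at t within J)"
      using v by (simp add: caratheodory_solution_on_def)
    then show "AE t in lebesgue. t \<in> {a..u} \<longrightarrow> (v has_vector_derivative f t (v t)) (at t within {a..u})"
      by eventually_elim (use sub in \<open>blast intro: has_vector_derivative_within_subset\<close>)
  qed (use u in simp)
  have diff: "x u - y u = (x a - y a) + integral {a..u} g" if u: "u \<in> {a..b}" for u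
  proof -
    have "((\<lambda>t. f t (x t) - f t (y t)) has_integral (x u - x a) - (y u - y a)) {a..u}"
      by (intro has_integral_diff ftc x y u)
    \<comment> \<open>The right endpoint, where the signal may already have switched, is a null
      set.\<close>
    then have "(g has_integral (x u - x a) - (y u - y a)) {a..u}"
      by (rule has_integral_spike[of "{b}", rotated 2]) (use u g in auto)
    then show ?thesis by (simp add: integral_unique)
  qed
  have "((\<lambda>u. (x a - y a) + integral {a..u} g) has_vector_derivative g t) (at t within {a..b})"
    using integral_has_vector_derivative[OF cont t] by (auto intro!: derivative_eq_intros)
  then show ?thesis
    by (rule has_vector_derivative_transform[OF t, rotated]) (rule diff)
qed

lemma caratheodory_solution_continuous_on:
  assumes "caratheodory_solution_on J f x" "{a..b} \<subseteq> J"
  shows "continuous_on {a..b} x"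
  using assms by (intro absolutely_continuous_on_imp_continuous_on)
    (auto simp: caratheodory_solution_on_def locally_absolutely_continuous_on_def)

section \<open>Exponential contraction of the switched system\<close>

theorem corollary2:
  fixes L\<^sub>1 L\<^sub>2 C\<^sub>1 C\<^sub>2 R V\<^sub>i\<^sub>n \<epsilon> T :: real
    and \<mu> :: "real \<Rightarrow> real"
    and \<phi> :: "real \<Rightarrow> real^4 \<Rightarrow> real^4"
  assumes "L\<^sub>1 > 0" "L\<^sub>2 > 0" "C\<^sub>1 > 0" "C\<^sub>2 > 0" "R > 0"
    and "0 < 2 * \<epsilon>" "2 * \<epsilon> \<le> T" "T < pi * sqrt (L\<^sub>1 * C\<^sub>1)"
    and "\<mu> \<in> PWM T \<epsilon>"
    and "\<And>x\<^sub>o. caratheodory_solution_on {0..}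
           (\<lambda>t x. A_mat L\<^sub>1 L\<^sub>2 C\<^sub>1 C\<^sub>2 R (\<mu> t) *v x + \<mu> t *\<^sub>R B_vec L\<^sub>1 L\<^sub>2 C\<^sub>1 C\<^sub>2 V\<^sub>i\<^sub>n)
           (\<lambda>t. \<phi> t x\<^sub>o)"
    and "\<And>x\<^sub>o. \<phi> 0 x\<^sub>o = x\<^sub>o"
  shows "\<exists>K>0. \<exists>lam>0. \<forall>t\<ge>0. \<forall>x\<^sub>o y\<^sub>o.
           norm (\<phi> t x\<^sub>o - \<phi> t y\<^sub>o) \<le> K * exp (- lam * t) * norm (x\<^sub>o - y\<^sub>o)"
proof -
  interpret cuk_converter L\<^sub>1 L\<^sub>2 C\<^sub>1 C\<^sub>2 R
    using assms by unfold_locales auto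
  have "\<omega> * T < pi"
    using assms by (simp add: \<omega>_def field_simps)
  then obtain K lam where K: "K > 0" "lam > 0" and decay:
    "\<And>z t. \<lbrakk>\<And>k::nat. \<exists>s. real k * T + \<epsilon> \<le> s \<and> s \<le> (real k + 1) * T - \<epsilon> \<and>
        solves field_on (real k * T) s z \<and> solves field_off s ((real k + 1) * T) z; t \<ge> 0\<rbrakk>
      \<Longrightarrow> norm (z t) \<le> K * exp (- lam * t) * norm (z 0)"
    using exponential_decay[of \<epsilon> T] assms(6,7) by auto
  \<comment> \<open>On an interval of constant signal the input term cancels in the difference,
    leaving the homogeneous mode; the half-open condition allows a switch at
    \<open>b\<close>.\<close>
  have solves: "solves F a b (\<lambda>t. \<phi> t x - \<phi> t y)"
    if "0 \<le> a" and \<mu>: "\<And>t. t \<in> {a..<b} \<Longrightarrow> \<mu> t = m"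
      and F: "\<And>x. A_mat L\<^sub>1 L\<^sub>2 C\<^sub>1 C\<^sub>2 R m *v x = F x" for F a b m x y
    unfolding solves_def
  proof
    fix t assume t: "t \<in> {a..b}"
    have sub: "{a..b} \<subseteq> {0..}" using that(1) by auto
    have "continuous_on {a..b} (\<lambda>t. \<phi> t x - \<phi> t y)"
      by (intro continuous_on_diff caratheodory_solution_continuous_on[OF assms(10) sub])
    then have "continuous_on {a..b} (\<lambda>t. A_mat L\<^sub>1 L\<^sub>2 C\<^sub>1 C\<^sub>2 R m *v (\<phi> t x - \<phi> t y))"
      by (rule bounded_linear.continuous_on[OF matrix_vector_mul_bounded_linear])
    then show "((\<lambda>t. \<phi> t x - \<phi> t y) has_vector_derivative F (\<phi> t x - \<phi> t y)) (at t within {a..b})"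
      unfolding F[symmetric]
      by (rule caratheodory_difference_has_vector_derivative[OF assms(10) assms(10) sub _ _ t])
        (simp add: \<mu> matrix_vector_mult_diff_distrib)
  qed
  have "norm (\<phi> t x - \<phi> t y) \<le> K * exp (- lam * t) * norm (x - y)" if "t \<ge> 0" for t x y
  proof -
    have "norm (\<phi> t x - \<phi> t y) \<le> K * exp (- lam * t) * norm (\<phi> 0 x - \<phi> 0 y)"
    proof (rule decay[OF _ that])
      fix k :: nat
      have "\<forall>k::int. \<exists>s. of_int k * T + \<epsilon> \<le> s \<and> s \<le> (of_int k + 1) * T - \<epsilon> \<and>
        (\<forall>t\<in>{of_int k * T..<s}. \<mu> t = 1/2) \<and> (\<forall>t\<in>{s..<(of_int k + 1) * T}. \<mu> t = -1/2)"
        using assms(9) by (simp add: PWM_def)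
      from spec[OF this, of "int k", unfolded of_int_of_nat_eq]
      obtain s where s: "real k * T + \<epsilon> \<le> s" "s \<le> (real k + 1) * T - \<epsilon>"
        "\<forall>t\<in>{real k * T..<s}. \<mu> t = 1/2" "\<forall>t\<in>{s..<(real k + 1) * T}. \<mu> t = -1/2"
        by blast
      have "0 \<le> real k * T" using assms(6,7) by simp
      then have "solves field_on (real k * T) s (\<lambda>t. \<phi> t x - \<phi> t y)"
        "solves field_off s ((real k + 1) * T) (\<lambda>t. \<phi> t x - \<phi> t y)"
        using s assms(6) by (auto intro!: solves[OF _ _ A_mat_on] solves[OF _ _ A_mat_off])
      with s show "\<exists>s. real k * T + \<epsilon> \<le> s \<and> s \<le> (real k + 1) * T - \<epsilon> \<and>
        solves field_on (real k * T) s (\<lambda>t. \<phi> t x - \<phi> t y) \<and>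
        solves field_off s ((real k + 1) * T) (\<lambda>t. \<phi> t x - \<phi> t y)" by blast
    qed
    then show ?thesis by (simp only: assms(11))
  qed
  with K show ?thesis by blast
qed

end
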